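(* For any (nonempty) sequence $u$, $\operatorname{Ssat}(u,n)=O(1)$ if and only if the first letter of $u$ and the last letter of $u$ each occur exactly once in $u$. Otherwise $\operatorname{Ssat}(u,n)=\Theta(n)$.
   Context: Sequences are finite words over an alphabet; a sequence on a given alphabet takes its letters from that alphabet (not every letter is required to appear). Two sequences are isomorphic if one is obtained from the other by a one-to-one renaming of letters. A copy of $u$ in a sequence is a (not necessarily contiguous) subsequence isomorphic to $u$. For a positive integer $m$, a sequence is $m$-sparse if any $m$ consecutive letters are distinct, meaning that any two occurrences of the same letter are at positions differing by at least $m$ (also for sequences shorter than $m$). Let $\|u\|$ be the number of distinct letters of $u$. A sequence $s$ on a given alphabet is $u$-semisaturated if $s$ is $\|u\|$-sparse and inserting any letter of the alphabet at any position of $s$ (including the beginning or the end) violates $\|u\|$-sparsity or creates a new copy of $u$, i.e. a copy of $u$ that uses the inserted occurrence; $s$ itself need not avoid $u$. $\operatorname{Ssat}(u,n)$ is the minimum possible length of a $u$-semisaturated sequence on an alphabet of size $n$. Asymptotic notation is for fixed $u$ as $n\to\infty$. *)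

theory Defs
  imports Complex_Main "HOL-Library.Landau_Symbols"
begin

definition isomorphic_seq :: "'a list \<Rightarrow> 'b list \<Rightarrow> bool" where
  "isomorphic_seq u v \<longleftrightarrow> (\<exists>f. inj_on f (set u) \<and> v = map f u)"

text \<open>A copy is given by its set of positions \<open>I\<close>, so that one can say which
  occurrences it uses; \<open>nths s I\<close> is the subsequence at these positions.\<close>

definition copy_at :: "'a list \<Rightarrow> 'b list \<Rightarrow> nat set \<Rightarrow> bool" where
  "copy_at u s I \<longleftrightarrow> I \<subseteq> {..<length s} \<and> isomorphic_seq u (nths s I)"

definition m_sparse :: "nat \<Rightarrow> 'a list \<Rightarrow> bool" where
  "m_sparse m s \<longleftrightarrow> (\<forall>i j. i < j \<longrightarrow> j < length s \<longrightarrow> s ! i = s ! j \<longrightarrow> m \<le> j - i)"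

definition num_letters :: "'a list \<Rightarrow> nat" where
  "num_letters u = card (set u)"

definition insert_letter :: "nat \<Rightarrow> 'a \<Rightarrow> 'a list \<Rightarrow> 'a list" where
  "insert_letter p x s = take p s @ x # drop p s"

text \<open>For \<open>p \<le> length s\<close> the inserted occurrence has position \<open>p\<close> in
  \<open>insert_letter p x s\<close>, so a new copy is one whose position set contains \<open>p\<close>.\<close>

definition semisaturated :: "'a list \<Rightarrow> 'b set \<Rightarrow> 'b list \<Rightarrow> bool" where
  "semisaturated u A s \<longleftrightarrow>
     set s \<subseteq> A \<and> m_sparse (num_letters u) s \<and>
     (\<forall>x\<in>A. \<forall>p\<le>length s.
        \<not> m_sparse (num_letters u) (insert_letter p x s) \<or>
        (\<exists>I. p \<in> I \<and> copy_at u (insert_letter p x s) I))"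

text \<open>Semisaturation is invariant under renaming the alphabet, so \<open>{..<n}\<close> stands for any
  alphabet of size \<open>n\<close>. A semisaturated sequence exists for every nonempty \<open>u\<close> and every \<open>n\<close>
  (a sequence listing all letters if \<open>n < num_letters u\<close>, otherwise sufficiently many
  repetitions of \<open>[0..<n]\<close>), so the minimum is taken over a nonempty set.\<close>

definition Ssat :: "'a list \<Rightarrow> nat \<Rightarrow> nat" where
  "Ssat u n = (LEAST l. \<exists>s. semisaturated u {..<n} s \<and> length s = l)"

end

theory Submission
  imports Defs "HOL-Library.Sublist"
begin

text \<open>
  Write \<open>r\<close> for the number of distinct letters of \<open>u\<close> and \<open>k\<close> for its length.

  Upper bounds come from the periodic word \<open>0, 1, \<dots>, m - 1, 0, 1, \<dots>\<close> consisting of \<open>2 * k\<close>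
  periods, where \<open>r \<le> m \<le> n\<close>. It is \<open>r\<close>-sparse, and \<open>k\<close> consecutive periods contain every
  word of length at most \<open>k\<close> on \<open>{..<m}\<close> as a subsequence. Wherever a letter \<open>x\<close> is inserted,
  \<open>k\<close> periods remain on one side of it. If they are on its right, let \<open>x\<close> be the first
  letter of a copy of \<open>u\<close> and find the rest of the copy on the right; if they are on its left,
  argue in the same way with the last letter of \<open>u\<close>. The rest of the copy must be a word on
  \<open>{..<m}\<close>. For \<open>m = n\<close> this is automatic, so that for \<open>n \<ge> r\<close> the minimal length
  is at most \<open>2 * k * n\<close>. If the first and the last letter of \<open>u\<close> occur only once, then \<open>x\<close> does not
  recur in the rest of the copy, so \<open>m = r\<close> is enough and the length does not depend on \<open>n\<close>
  (lemma \<open>semisaturated_periodic_word\<close>).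

  For the lower bound, suppose that the first letter of \<open>u\<close> occurs again, and insert a letter
  \<open>x\<close> at the beginning of a semisaturated sequence. A new copy starts with \<open>x\<close> and needs a
  second \<open>x\<close>, and a violation of sparsity also needs a second \<open>x\<close>. Hence every letter of the
  alphabet already occurs, and the length is at least \<open>n\<close> (lemma
  \<open>length_semisaturated_ge\<close>). The last letter is handled by inserting at the end.
\<close>

section \<open>Periodic words\<close>

definition periodic_word :: "nat \<Rightarrow> nat \<Rightarrow> nat list" where
  "periodic_word m l = map (\<lambda>i. i mod m) [0..<l]"

lemma length_periodic_word [simp]: "length (periodic_word m l) = l"
  by (simp add: periodic_word_def)

lemma m_sparse_periodic_word:
  assumes "r \<le> m"
  shows "m_sparse r (periodic_word m l)"
  unfolding m_sparse_def
proof (intro allI impI)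
  fix i j assume ij: "i < j" "j < length (periodic_word m l)"
    and eq: "periodic_word m l ! i = periodic_word m l ! j"
  have "j mod m = i mod m" using ij eq by (simp add: periodic_word_def)
  then have "m dvd j - i" using ij(1) by (simp add: mod_eq_dvd_iff_nat)
  then have "m \<le> j - i" using ij(1) by (simp add: dvd_imp_le)
  then show "r \<le> j - i" using assms by simp
qed

lemma residue_in_window:
  fixes y m p :: nat
  assumes "y < m"
  obtains i where "p \<le> i" "i < p + m" "i mod m = y"
proof
  let ?d = "(y + (m - p mod m)) mod m"
  have m: "0 < m" using assms by simp
  show "p \<le> p + ?d" by simp
  show "p + ?d < p + m" using m by simp
  have "(p + ?d) mod m = (p mod m + (y + (m - p mod m))) mod m"
    by (simp add: mod_simps)
  also have "p mod m + (y + (m - p mod m)) = y + m"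
    using mod_less_divisor[OF m, of p] by linarith
  finally show "(p + ?d) mod m = y" using assms by simp
qed

text \<open>The word is embedded greedily: each of its letters is found within one period after
  the previous one.\<close>

lemma subseq_periodic_window:
  assumes "set w \<subseteq> {..<m}" "p + m * length w \<le> q"
  shows "subseq w (map (\<lambda>i. i mod m) [p..<q])"
  using assms
proof (induction w arbitrary: p)
  case Nil
  then show ?case by simp
next
  case (Cons y w)
  obtain i where i: "p \<le> i" "i < p + m" "i mod m = y"
    using residue_in_window[of y m p] Cons.prems(1) by auto
  have "Suc i + m * length w \<le> q" using i(2) Cons.prems(2) by simp
  moreover from this have "[p..<q] = [p..<i] @ i # [Suc i..<q]"
    using i(1) upt_add_eq_append[of p i "q - i"] upt_conv_Cons[of i q] by simp
  ultimately show ?case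
    using Cons.IH[of "Suc i"] Cons.prems(1) i(3) by (simp add: list_emb_append2)
qed

lemma subseq_drop_periodic_word:
  assumes "set w \<subseteq> {..<m}" "p + m * length w \<le> l"
  shows "subseq w (drop p (periodic_word m l))"
  using subseq_periodic_window[OF assms] by (simp add: periodic_word_def drop_map)

lemma subseq_take_periodic_word:
  assumes "set w \<subseteq> {..<m}" "m * length w \<le> p" "p \<le> l"
  shows "subseq w (take p (periodic_word m l))"
  using subseq_periodic_window[of w m 0 p] assms by (simp add: periodic_word_def take_map)

section \<open>Copies through an inserted letter\<close>

lemma copy_through_inserted_letter:
  assumes "p \<le> length s" "inj_on f (set u)" "map f u = a @ x # b"
    and "subseq a (take p s)" "subseq b (drop p s)"
  shows "\<exists>I. p \<in> I \<and> copy_at u (insert_letter p x s) I"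
proof -
  obtain A where A: "a = nths (take p s) A" using assms(4) by (auto simp: subseq_conv_nths)
  obtain B where B: "b = nths (drop p s) B" using assms(5) by (auto simp: subseq_conv_nths)
  let ?t = "insert_letter p x s"
  \<comment> \<open>The given \<open>A\<close> and \<open>B\<close> may contain indices past the end of the two halves, which \<open>nths\<close>
    ignores; intersecting removes them before the halves are joined around position \<open>p\<close>.\<close>
  let ?I = "((A \<inter> {..<p}) \<union> {p} \<union> (\<lambda>j. Suc (p + j)) ` B) \<inter> {..<length ?t}"
  have len: "length ?t = Suc (length s)" using assms(1) by (simp add: insert_letter_def)
  have "nths (take p s) ?I = nths (take p s) A"
    using assms(1) unfolding nths_def len
    by (intro arg_cong[where f = "map fst"] filter_cong) (auto dest!: set_zip_rightD)
  moreover have "nths (drop p s) {j. Suc j \<in> {j. j + p \<in> ?I}} = nths (drop p s) B"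
    using assms(1) unfolding nths_def len
    by (intro arg_cong[where f = "map fst"] filter_cong)
       (auto dest!: set_zip_rightD simp: add.commute)
  ultimately have "nths ?t ?I = a @ x # b"
    using assms(1) len A B by (simp add: insert_letter_def nths_append nths_Cons)
  moreover have "?I \<subseteq> {..<length ?t}" "p \<in> ?I" using assms(1) len by auto
  ultimately show ?thesis
    unfolding copy_at_def isomorphic_seq_def using assms(2,3) by metis
qed

lemma ex_inj_on_with_value:
  fixes U :: "'a set" and x :: nat
  assumes "finite U" "c \<in> U" "card U \<le> m"
  obtains f where "inj_on f U" "f c = x" "f ` (U - {c}) \<subseteq> {..<m}"
proof -
  have "card (U - {c}) = card U - 1" using assms(1,2) by simp
  also have "\<dots> \<le> card ({..<m} - {x})"
    using assms(3) by (auto simp: card_Diff_singleton_if)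
  finally obtain g where g: "inj_on g (U - {c})" "g ` (U - {c}) \<subseteq> {..<m} - {x}"
    using card_le_inj[of "U - {c}" "{..<m} - {x}"] assms(1) by auto
  show ?thesis
  proof
    show "inj_on (g(c := x)) U" using g by (auto simp: inj_on_def)
    show "(g(c := x)) c = x" by simp
    show "(g(c := x)) ` (U - {c}) \<subseteq> {..<m}" using g(2) by auto
  qed
qed

lemma count_list_hd_eq_1_iff:
  "u \<noteq> [] \<Longrightarrow> count_list u (hd u) = 1 \<longleftrightarrow> hd u \<notin> set (tl u)"
  by (cases u) (auto simp: count_list_0_iff)

lemma count_list_last_eq_1_iff:
  "u \<noteq> [] \<Longrightarrow> count_list u (last u) = 1 \<longleftrightarrow> last u \<notin> set (butlast u)"
  by (cases u rule: rev_cases) (auto simp: count_list_0_iff)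

text \<open>The disjunction is what keeps the rest of the copy inside \<open>{..<m}\<close>: the inserted letter
  may lie outside \<open>{..<m}\<close> only if the copy does not need it again. The position \<open>m * length u\<close>
  is the middle of the word, so the longer side always has \<open>length u\<close> full periods.\<close>

lemma new_copy_in_periodic_word:
  assumes "u \<noteq> []" "num_letters u \<le> m"
    and "x < m \<or> count_list u (hd u) = 1 \<and> count_list u (last u) = 1"
    and "p \<le> 2 * (m * length u)"
  shows "\<exists>I. p \<in> I \<and> copy_at u (insert_letter p x (periodic_word m (2 * (m * length u)))) I"
proof (cases "p \<le> m * length u")
  case True
  obtain f where f: "inj_on f (set u)" "f (hd u) = x" "f ` (set u - {hd u}) \<subseteq> {..<m}"
    using ex_inj_on_with_value[of "set u" "hd u" m x] assms(1,2)
    by (auto simp: num_letters_def)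
  have "f y < m" if "y \<in> set (tl u)" for y
    using that f assms(1,3) count_list_hd_eq_1_iff[OF assms(1)]
    by (cases "y = hd u") (auto dest: list.set_sel(2))
  then have "set (map f (tl u)) \<subseteq> {..<m}" by auto
  moreover have "p + m * length (map f (tl u)) \<le> 2 * (m * length u)"
    using True by (simp add: diff_mult_distrib2)
  ultimately have "subseq (map f (tl u)) (drop p (periodic_word m (2 * (m * length u))))"
    by (rule subseq_drop_periodic_word)
  moreover have "map f u = [] @ x # map f (tl u)"
    using f(2) assms(1) by (cases u) auto
  moreover have "subseq [] (take p (periodic_word m (2 * (m * length u))))" by simp
  ultimately show ?thesis
    using copy_through_inserted_letter[OF _ f(1)] assms(4) length_periodic_word by metis
next
  case False
  obtain f where f: "inj_on f (set u)" "f (last u) = x" "f ` (set u - {last u}) \<subseteq> {..<m}"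
    using ex_inj_on_with_value[of "set u" "last u" m x] assms(1,2)
    by (auto simp: num_letters_def)
  have "f y < m" if "y \<in> set (butlast u)" for y
    using that f assms(1,3) count_list_last_eq_1_iff[OF assms(1)]
    by (cases "y = last u") (auto dest: in_set_butlastD)
  then have "set (map f (butlast u)) \<subseteq> {..<m}" by auto
  moreover have "m * length (map f (butlast u)) \<le> p"
    using False by (simp add: diff_mult_distrib2)
  ultimately have "subseq (map f (butlast u)) (take p (periodic_word m (2 * (m * length u))))"
    using assms(4) by (rule subseq_take_periodic_word)
  moreover have "map f u = map f (butlast u) @ x # []"
    using f(2) assms(1) by (cases u rule: rev_cases) auto
  moreover have "subseq [] (drop p (periodic_word m (2 * (m * length u))))" by simp
  ultimately show ?thesis
    using copy_through_inserted_letter[OF _ f(1)] assms(4) length_periodic_word by metis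
qed

section \<open>Bounds on semisaturated sequences\<close>

lemma semisaturated_periodic_word:
  assumes "u \<noteq> []" "num_letters u \<le> m" "m \<le> n"
    and "m = n \<or> count_list u (hd u) = 1 \<and> count_list u (last u) = 1"
  shows "semisaturated u {..<n} (periodic_word m (2 * (m * length u)))"
proof -
  have "0 < num_letters u" using assms(1) by (simp add: num_letters_def card_gt_0_iff)
  then have "0 < m" using assms(2) by simp
  then have "set (periodic_word m (2 * (m * length u))) \<subseteq> {..<n}"
    using assms(3) by (auto simp: periodic_word_def intro: less_le_trans[OF mod_less_divisor])
  then show ?thesis
    using assms m_sparse_periodic_word new_copy_in_periodic_word[OF assms(1,2)]
    by (auto simp: semisaturated_def)
qed

lemma Ssat_le:
  "semisaturated u {..<n} s \<Longrightarrow> Ssat u n \<le> length s"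
  unfolding Ssat_def by (rule Least_le) auto

lemma Ssat_attained:
  assumes "u \<noteq> []" "num_letters u \<le> n"
  obtains s where "semisaturated u {..<n} s" "length s = Ssat u n"
proof -
  have "\<exists>l s. semisaturated u {..<n} s \<and> length s = l"
    using semisaturated_periodic_word[OF assms] by blast
  from LeastI_ex[OF this] show ?thesis using that unfolding Ssat_def by blast
qed

lemma m_sparse_insert_first:
  assumes "m_sparse m s" "x \<notin> set s"
  shows "m_sparse m (insert_letter 0 x s)"
  unfolding m_sparse_def
proof (intro allI impI)
  fix i j assume ij: "i < j" "j < length (insert_letter 0 x s)"
    and eq: "insert_letter 0 x s ! i = insert_letter 0 x s ! j"
  then obtain j' where j': "j = Suc j'" "j' < length s"
    by (cases j) (auto simp: insert_letter_def)
  show "m \<le> j - i"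
  proof (cases i)
    case 0
    then show ?thesis using eq j' assms(2) nth_mem[of j' s] by (simp add: insert_letter_def)
  next
    case (Suc i')
    then show ?thesis using eq ij j' assms(1) by (simp add: insert_letter_def m_sparse_def)
  qed
qed

lemma m_sparse_insert_last:
  assumes "m_sparse m s" "x \<notin> set s"
  shows "m_sparse m (insert_letter (length s) x s)"
  unfolding m_sparse_def
proof (intro allI impI)
  fix i j assume ij: "i < j" "j < length (insert_letter (length s) x s)"
    and eq: "insert_letter (length s) x s ! i = insert_letter (length s) x s ! j"
  have i: "i < length s" using ij by (simp add: insert_letter_def)
  show "m \<le> j - i"
  proof (cases "j < length s")
    case True
    then show ?thesis
      using eq ij i assms(1) by (simp add: insert_letter_def m_sparse_def nth_append)
  next
    case False
    then have "j = length s" using ij by (simp add: insert_letter_def)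
    then show ?thesis
      using eq i assms(2) nth_mem[OF i] by (simp add: insert_letter_def nth_append)
  qed
qed

lemma new_copy_at_first_recurs:
  assumes "copy_at u (insert_letter 0 x s) I" "0 \<in> I"
    and "u \<noteq> []" "count_list u (hd u) \<noteq> 1"
  shows "x \<in> set s"
proof -
  obtain f where "nths (x # s) I = map f u"
    using assms(1) by (auto simp: copy_at_def isomorphic_seq_def insert_letter_def)
  then have *: "x # nths s {j. Suc j \<in> I} = map f u"
    using assms(2) by (simp add: nths_Cons)
  have "hd u \<in> set (tl u)" using assms(3,4) count_list_hd_eq_1_iff by metis
  then have "f (hd u) \<in> set (map f (tl u))" by simp
  moreover have "f (hd u) = x" "map f (tl u) = nths s {j. Suc j \<in> I}"
    using * assms(3) by (cases u; simp)+
  ultimately show ?thesis using set_nths_subset by fastforce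
qed

lemma new_copy_at_last_recurs:
  assumes "copy_at u (insert_letter (length s) x s) I" "length s \<in> I"
    and "u \<noteq> []" "count_list u (last u) \<noteq> 1"
  shows "x \<in> set s"
proof -
  obtain f where "nths (s @ [x]) I = map f u"
    using assms(1) by (auto simp: copy_at_def isomorphic_seq_def insert_letter_def)
  then have *: "nths s I @ [x] = map f u"
    using assms(2) by (simp add: nths_append nths_singleton)
  have "last u \<in> set (butlast u)" using assms(3,4) count_list_last_eq_1_iff by metis
  then have "f (last u) \<in> set (map f (butlast u))" by simp
  moreover have "f (last u) = x" "map f (butlast u) = nths s I"
    using * assms(3) by (cases u rule: rev_cases; simp)+
  ultimately show ?thesis using set_nths_subset by fastforce
qed

lemma alphabet_subset_semisaturated:
  assumes "semisaturated u A s" "u \<noteq> []"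
    and "\<not> (count_list u (hd u) = 1 \<and> count_list u (last u) = 1)"
  shows "A \<subseteq> set s"
proof
  fix x assume x: "x \<in> A"
  have sparse: "m_sparse (num_letters u) s" using assms(1) by (simp add: semisaturated_def)
  have insertion: "\<not> m_sparse (num_letters u) (insert_letter p x s) \<or>
      (\<exists>I. p \<in> I \<and> copy_at u (insert_letter p x s) I)" if "p \<le> length s" for p
    using assms(1) x that by (simp add: semisaturated_def)
  show "x \<in> set s"
  proof (cases "count_list u (hd u) = 1")
    case False
    then show ?thesis
      using insertion[of 0] m_sparse_insert_first[OF sparse, of x]
        new_copy_at_first_recurs[OF _ _ assms(2), where x = x and s = s]
      by auto
  next
    case True
    then show ?thesis
      using insertion[of "length s"] m_sparse_insert_last[OF sparse, of x]
        new_copy_at_last_recurs[OF _ _ assms(2), where x = x and s = s] assms(3)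
      by auto
  qed
qed

lemma length_semisaturated_ge:
  assumes "semisaturated u {..<n} s" "u \<noteq> []"
    and "\<not> (count_list u (hd u) = 1 \<and> count_list u (last u) = 1)"
  shows "n \<le> length s"
  using card_mono[OF _ alphabet_subset_semisaturated[OF assms]] card_length[of s] by simp

section \<open>The dichotomy\<close>

theorem corollary4p6:
  fixes u :: "'a list"
  assumes "u \<noteq> []"
  shows "((\<lambda>n. real (Ssat u n)) \<in> O(\<lambda>n. 1) \<longleftrightarrow>
            count_list u (hd u) = 1 \<and> count_list u (last u) = 1) \<and>
         (\<not> (count_list u (hd u) = 1 \<and> count_list u (last u) = 1) \<longrightarrow>
            (\<lambda>n. real (Ssat u n)) \<in> \<Theta>(\<lambda>n. real n))"
proof -
  let ?unique = "count_list u (hd u) = 1 \<and> count_list u (last u) = 1"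
  let ?r = "num_letters u"
  have bounded: "(\<lambda>n. real (Ssat u n)) \<in> O(\<lambda>n. 1)" if unique: "?unique"
  proof -
    have "Ssat u n \<le> 2 * (?r * length u)" if "?r \<le> n" for n
      using Ssat_le[OF semisaturated_periodic_word[OF assms order_refl that disjI2[OF unique]]]
      by (simp only: length_periodic_word)
    then have "\<forall>\<^sub>F n in at_top.
        norm (real (Ssat u n)) \<le> real (2 * (?r * length u)) * norm (1 :: real)"
      unfolding norm_of_nat norm_one mult_1_right of_nat_le_iff
      by (rule eventually_mono[OF eventually_ge_at_top])
    then show ?thesis by (rule bigoI)
  qed
  have linear: "(\<lambda>n. real (Ssat u n)) \<in> \<Theta>(\<lambda>n. real n)" if not_unique: "\<not> ?unique"
  proof
    have "Ssat u n \<le> 2 * length u * n" if "?r \<le> n" for n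
      using Ssat_le[OF semisaturated_periodic_word[OF assms that order_refl disjI1[OF refl]]]
      by (simp only: length_periodic_word ac_simps)
    then have "\<forall>\<^sub>F n in at_top. norm (real (Ssat u n)) \<le> real (2 * length u) * norm (real n)"
      unfolding norm_of_nat of_nat_mult[symmetric] of_nat_le_iff
      by (rule eventually_mono[OF eventually_ge_at_top])
    then show "(\<lambda>n. real (Ssat u n)) \<in> O(\<lambda>n. real n)" by (rule bigoI)
    have "n \<le> Ssat u n" if "?r \<le> n" for n
      using Ssat_attained[OF assms that] length_semisaturated_ge[OF _ assms not_unique] by metis
    then have "\<forall>\<^sub>F n in at_top. norm (real n) \<le> norm (real (Ssat u n))"
      unfolding norm_of_nat of_nat_le_iff by (rule eventually_mono[OF eventually_ge_at_top])
    then show "(\<lambda>n. real (Ssat u n)) \<in> \<Omega>(\<lambda>n. real n)"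
      by (intro landau_omega.bigI[of 1]) auto
  qed
  have "(\<lambda>n. real (Ssat u n)) \<notin> O(\<lambda>n. 1)" if "\<not> ?unique"
  proof
    assume "(\<lambda>n. real (Ssat u n)) \<in> O(\<lambda>n. 1)"
    moreover have "(\<lambda>n. real n) \<in> O(\<lambda>n. real (Ssat u n))"
      using linear[OF that] by (simp add: bigtheta_def bigomega_iff_bigo)
    ultimately have "(\<lambda>n. real n) \<in> O(\<lambda>n. 1 :: real)"
      using landau_o.big_trans by blast
    then obtain c where "\<forall>\<^sub>F n in sequentially. norm (real n) \<le> c * norm (1 :: real)"
      by (auto elim!: landau_o.bigE)
    then have "\<forall>\<^sub>F n in sequentially. real n \<le> c" by simp
    moreover have "\<forall>\<^sub>F n in sequentially. c < real n"
      using filterlim_real_sequentially by (simp add: filterlim_at_top_dense)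
    ultimately have "\<forall>\<^sub>F n :: nat in sequentially. False" by eventually_elim simp
    then show False by simp
  qed
  with bounded linear show ?thesis by blast
qed

end
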